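(* Let $R$ be a Gorenstein local (or graded) ring with maximal ideal $\mathfrak m$, $2,3\notin\mathfrak m$, let $I\subseteq R$ be a perfect ideal of height $3$ with minimal free resolution $\mathbb{A}:0\to A_3\xrightarrow{a_3}A_2\xrightarrow{a_2}A_1\xrightarrow{a_1}R$ of $R/I$, let $\mathfrak a\subseteq I$ be a regular sequence of maximal length (i.e. of length $3$), $J=(\mathfrak a):I$, and let $\mathbb{D}:0\to D_3=A_1^*\xrightarrow{d_3}D_2=A_2^*\oplus B_2\xrightarrow{d_2}D_1=A_3^*\oplus B_1\xrightarrow{d_1}R$ be the (not necessarily minimal) mapping-cone free resolution of $R/J$ described in the context. Put $\varepsilon_{s_1,s_2,s_3}=\alpha_1(s_1)\wedge\alpha_1(s_2)\wedge\alpha_1(s_3)$ and $\varepsilon_{i,s_1,s_2,s_3}=e_i\wedge\varepsilon_{s_1,s_2,s_3}$. Then the multiplication map $\bigwedge^3D_1\to D_3$ is described as follows: $$s_1\cdot s_2\cdot s_3=w=\sum_{i=1}^{r_1}x_i\epsilon_i,$$ $$\gamma_1\cdot s_1\cdot s_2=\sum_{i=1}^{r_1}\langle\alpha_1(s_1)\cdot\alpha_1(s_2)\cdot e_i,\gamma_1\rangle\,\epsilon_i,$$ $$\gamma_1\cdot\gamma_2\cdot s_1=\sum_{i=1}^{r_1}\langle w^{(1)}_{2,1}(\varepsilon_{i,s_1,s_2,s_3}\otimes\alpha_1(s_1)),\gamma_1\wedge\gamma_2\rangle\,\epsilon_i,$$ $$\gamma_1\cdot\gamma_2\cdot\gamma_3=\sum_{i=1}^{r_1}\langle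 w^{(1)}_{3,1}(\varepsilon_{i,s_1,s_2,s_3}\otimes\varepsilon_{s_1,s_2,s_3}),\gamma_1\wedge\gamma_2\wedge\gamma_3\rangle\,\epsilon_i.$$ The same formulas hold for all the possible combinations of basis elements $\gamma_u$ and $s_j$.
   Context: Bases: $\{e_i\}_{i=1}^{r_1}$, $\{f_h\}_{h=1}^{r_2}$, $\{g_u\}_{u=1}^{r_3}$ of $A_1,A_2,A_3$; dual bases $\{\epsilon_i\},\{\phi_h\},\{\gamma_u\}$; $x_i=a_1(e_i)$. $\langle\cdot,\cdot\rangle$ is evaluation of an element of a module against an element of the dual. Structure maps on $\mathbb{A}$, chosen successively as lifts (below $e_1,e_2,\dots$ denote arbitrary elements of $A_1$, $\varepsilon_{i_1,\dots,i_t}=e_{i_1}\wedge\dots\wedge e_{i_t}$, and a hat means omission): - $w^{(3)}_1:\bigwedge^2A_1\to A_2$, written $e\cdot e'$, with $a_2(e\cdot e')=a_1(e)e'-a_1(e')e$. - $w^{(2)}_1:A_1\otimes A_2\to A_3$, written $e\cdot f$, with $a_3(e\cdot f)=a_1(e)f-e\cdot a_2(f)$. - $w^{(1)}_1:\bigwedge^3A_1\to A_3$, written $e\cdot e'\cdot e''$, with $a_3(e\cdot e'\cdot e'')=a_1(e)\,e'\cdot e''-a_1(e')\,e\cdot e''+a_1(e'')\,e\cdot e'$. - $w^{(3)}_2:\bigwedge^4A_1\to A_3\otimes A_2$: a lift, along the map $A_3\otimes A_2\to S_2A_2$ induced by $a_3$, of $\varepsilon_{i,j,k,l}\mapsto e_i\cdot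 e_j\otimes e_k\cdot e_l-e_i\cdot e_k\otimes e_j\cdot e_l+e_i\cdot e_l\otimes e_j\cdot e_k$. - $w^{(2)}_2:\bigwedge^3A_1\otimes A_2\to\bigwedge^2A_3$: the lift, along the map $\bigwedge^2A_3\to A_3\otimes A_2$ induced by $a_3$, of $\varepsilon_{i,j,k}\otimes f_h\mapsto e_i\cdot e_j\otimes e_k\cdot f_h-e_i\cdot e_k\otimes e_j\cdot f_h+e_j\cdot e_k\otimes e_i\cdot f_h-w^{(3)}_2(\varepsilon_{i,j,k}\wedge a_2(f_h))+f_h\otimes e_i\cdot e_j\cdot e_k$. - $w^{(3)}_{3,1}:\bigwedge^5A_1\otimes A_1\to\bigwedge^2A_3\otimes A_2$: a lift, along the map $\bigwedge^2A_3\otimes A_2\to A_3\otimes S_2A_2$ induced by $a_3$, of the image in $A_3\otimes S_2A_2$ (by symmetrization) of $\varepsilon_{1,\dots,5}\otimes e_6\mapsto\sum_{i=1}^5(-1)^{i+1}w^{(3)}_2(e_1\wedge\dots\widehat{e_i}\dots\wedge e_5)\otimes e_i\cdot e_6+\frac12\sum_{1\le i<j\le5}(-1)^{i+j}w^{(3)}_2(e_1\wedge\dots\widehat{e_i}\dots\widehat{e_j}\dots\wedge e_6)\otimes e_i\cdot e_j$. - $w^{(1)}_{2,1}:\bigwedge^4A_1\otimes A_1\to\bigwedge^2A_3$: the lift, along the map $\bigwedge^2A_3\to A_3\otimes A_2$ induced by $a_3$, of $\varepsilon_{1,\dots,4}\otimes e_5\mapsto e_1\cdot e_5\otimes e_2\cdot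 e_3\cdot e_4-e_2\cdot e_5\otimes e_1\cdot e_3\cdot e_4+e_3\cdot e_5\otimes e_1\cdot e_2\cdot e_4-e_4\cdot e_5\otimes e_1\cdot e_2\cdot e_3+a_1(e_1)w^{(3)}_2(\varepsilon_{2,3,4,5})-a_1(e_2)w^{(3)}_2(\varepsilon_{1,3,4,5})+a_1(e_3)w^{(3)}_2(\varepsilon_{1,2,4,5})-a_1(e_4)w^{(3)}_2(\varepsilon_{1,2,3,5})$. - $w^{(1)}_{3,1}:\bigwedge^4A_1\otimes\bigwedge^3A_1\to\bigwedge^3A_3$: the lift, along the map $\bigwedge^3A_3\to\bigwedge^2A_3\otimes A_2$ induced by $a_3$, of $\varepsilon_{1,\dots,4}\otimes\varepsilon_{5,6,7}\mapsto\sum_{i=5}^7(-1)^{i+1}w^{(1)}_{2,1}(\varepsilon_{1,\dots,4}\otimes e_i)\otimes e_j\cdot e_k+\sum_{i=1}^4(-1)^{i+1}w^{(3)}_2(\varepsilon_{5,6,7,i})\otimes e_j\cdot e_k\cdot e_r-\sum_{i=1}^4\sum_{j=5}^7(-1)^{i+j}a_1(e_i)\,w^{(3)}_{3,1}(e_1\wedge\dots\widehat{e_i}\dots\widehat{e_j}\dots\wedge e_7\otimes e_j)$, where in the first sum $j<k$ are the elements of $\{5,6,7\}\setminus\{i\}$, in the second $j<k<r$ are the elements of $\{1,2,3,4\}\setminus\{i\}$, and in the second sum the two $A_3$-factors are wedged together. The complex $\mathbb{D}$. $\mathbb{B}$ is the Koszul complex resolving $R/(\mathfrak a)$, with differentials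 $b_i$, bases $\{s_1,s_2,s_3\}$ of $B_1$, $\{t_1,t_2,t_3\}$ of $B_2$, $\{w\}$ of $B_3$, and products $s_i\cdot s_j=(-1)^{i+j+1}t_k$ ($i<j$, $\{i,j,k\}=\{1,2,3\}$), $s_1\cdot s_2\cdot s_3=w$. The map $\alpha_1:B_1\to A_1$, $\alpha_1(s_j)=\sum_iu_{ij}e_i$, lifts $R/(\mathfrak a)\to R/I$, so the elements of $\mathfrak a$ are $\sum_iu_{ij}x_i$, $j=1,2,3$. Put $\beta_1(\epsilon_k)=\sum_{j=1}^3u_{kj}t_j$, $\beta_2(\phi_h)=\sum_{j=1}^3(-1)^{j+1}\langle\alpha_1(s_{k_1})\cdot\alpha_1(s_{k_2}),\phi_h\rangle s_j$ with $k_1<k_2$ the indices in $\{1,2,3\}\setminus\{j\}$, and $\beta_3(\gamma_t)=\langle\alpha_1(s_1)\cdot\alpha_1(s_2)\cdot\alpha_1(s_3),\gamma_t\rangle$. The differentials of $\mathbb{D}$ are $d_1=\begin{bmatrix}\beta_3&b_1\end{bmatrix}$, $d_2=\begin{bmatrix}a_3^*&0\\-\beta_2&-b_2\end{bmatrix}$, $d_3=\begin{bmatrix}a_2^*\\\beta_1\end{bmatrix}$. In the first formula of the claim $w$ is identified with the element $\sum_ix_i\epsilon_i$ of $D_3$. The multiplication $\bigwedge^3D_1\to D_3$ is the one computed from the relation $d_3(x\cdot y\cdot z)=d_1(x)\,y\cdot z-d_1(y)\,x\cdot z+d_1(z)\,x\cdot y$, where the multiplication $\bigwedge^2D_1\to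 D_2$ is taken to be: $s_i\cdot s_j=(-1)^{i+j+1}t_k$; $s_i\cdot\gamma_t=\sum_{h=1}^{r_2}\langle\alpha_1(s_i)\cdot f_h,\gamma_t\rangle\phi_h$; $\gamma_u\cdot\gamma_t=\sum_{h=1}^{r_2}\langle w^{(2)}_2(\varepsilon_{s_1,s_2,s_3}\otimes f_h),\gamma_u\wedge\gamma_t\rangle\phi_h$.
   Formalization: Context formulas corrected, since as printed the lifts or triple product need not exist: last two signs in w^(2)_2 flipped; the formula for s_i·γ_t is taken for γ_t·s_i; in w^(1)_{3,1} the third sum gets coefficient 2/3 and the triple product is wedged on the left. *)

theory Defs
  imports "HOL-Analysis.Analysis"
begin

section \<open>Commutative algebra\<close>

text \<open>The base ring is a type of class \<open>comm_ring_1\<close>. A ring is a module over itself via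
  \<open>(*)\<close>, so ideals and generated ideals are \<open>module.subspace (*)\<close> and \<open>module.span (*)\<close>.\<close>

lemma module_mult: "module ((*) :: 'r::comm_ring_1 \<Rightarrow> 'r \<Rightarrow> 'r)"
  by unfold_locales (simp_all add: algebra_simps)

abbreviation ring_ideal :: "'r::comm_ring_1 set \<Rightarrow> bool" where
  "ring_ideal \<equiv> module.subspace (*)"

abbreviation ideal_gen :: "'r::comm_ring_1 set \<Rightarrow> 'r set" where
  "ideal_gen \<equiv> module.span (*)"

definition ideal_quotient :: "'r::comm_ring_1 set \<Rightarrow> 'r set \<Rightarrow> 'r set" where
  "ideal_quotient K I = {r. \<forall>s\<in>I. r * s \<in> K}"

definition prime_ring_ideal :: "'r::comm_ring_1 set \<Rightarrow> bool" where
  "prime_ring_ideal P \<longleftrightarrow>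
     ring_ideal P \<and> P \<noteq> UNIV \<and> (\<forall>a b. a * b \<in> P \<longrightarrow> a \<in> P \<or> b \<in> P)"

definition maximal_ring_ideal :: "'r::comm_ring_1 set \<Rightarrow> bool" where
  "maximal_ring_ideal M \<longleftrightarrow>
     ring_ideal M \<and> M \<noteq> UNIV \<and> (\<forall>K. ring_ideal K \<and> M \<subseteq> K \<and> K \<noteq> UNIV \<longrightarrow> K = M)"

definition noetherian_ring :: "'r::comm_ring_1 itself \<Rightarrow> bool" where
  "noetherian_ring _ \<longleftrightarrow>
     (\<forall>K :: 'r set. ring_ideal K \<longrightarrow> (\<exists>S. finite S \<and> K = ideal_gen S))"

definition local_ring :: "'r::comm_ring_1 set \<Rightarrow> bool" where
  "local_ring M \<longleftrightarrow> maximal_ring_ideal M \<and> (\<forall>K. maximal_ring_ideal K \<longrightarrow> K = M)"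

definition graded_ring :: "(nat \<Rightarrow> 'r::comm_ring_1 set) \<Rightarrow> bool" where
  "graded_ring G \<longleftrightarrow>
     (\<forall>n. 0 \<in> G n \<and> (\<forall>a\<in>G n. \<forall>b\<in>G n. a - b \<in> G n)) \<and>
     1 \<in> G 0 \<and>
     (\<forall>m n. \<forall>a\<in>G m. \<forall>b\<in>G n. a * b \<in> G (m + n)) \<and>
     (\<forall>r. \<exists>!c. (\<forall>n. c n \<in> G n) \<and> finite {n. c n \<noteq> 0} \<and> r = (\<Sum>n | c n \<noteq> 0. c n))"

definition homogeneous_ideal :: "(nat \<Rightarrow> 'r::comm_ring_1 set) \<Rightarrow> 'r set \<Rightarrow> bool" where
  "homogeneous_ideal G K \<longleftrightarrow> ring_ideal K \<and> K = ideal_gen (K \<inter> (\<Union>n. G n))"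

text \<open>A graded ring with a maximal ideal \<open>M\<close> which is its only maximal homogeneous ideal; the
  degree zero part is then a local ring, for instance a field.\<close>

definition graded_local_ring :: "(nat \<Rightarrow> 'r::comm_ring_1 set) \<Rightarrow> 'r set \<Rightarrow> bool" where
  "graded_local_ring G M \<longleftrightarrow>
     graded_ring G \<and> homogeneous_ideal G M \<and> maximal_ring_ideal M \<and>
     (\<forall>K. homogeneous_ideal G K \<and> K \<noteq> UNIV \<longrightarrow> K \<subseteq> M)"

text \<open>Finite free modules of varying rank, needed for resolutions of unspecified shape.
  The free module of rank \<open>n\<close> consists of the sequences vanishing from index \<open>n\<close> on;
  an \<open>m \<times> n\<close> matrix is a function of a row and a column index.\<close>

definition free_mod :: "nat \<Rightarrow> (nat \<Rightarrow> 'r::comm_ring_1) set" where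
  "free_mod n = {v. \<forall>i\<ge>n. v i = 0}"

definition mat_app ::
  "nat \<Rightarrow> nat \<Rightarrow> (nat \<Rightarrow> nat \<Rightarrow> 'r::comm_ring_1) \<Rightarrow> (nat \<Rightarrow> 'r) \<Rightarrow> (nat \<Rightarrow> 'r)" where
  "mat_app m n A v = (\<lambda>i. if i < m then \<Sum>j<n. A i j * v j else 0)"

text \<open>\<open>F\<^sub>0 \<leftarrow> F\<^sub>1 \<leftarrow> F\<^sub>2 \<leftarrow> \<dots>\<close> with \<open>F\<^sub>k\<close> free of rank \<open>r k\<close> and \<open>d k : F\<^sub>k\<^sub>+\<^sub>1 \<rightarrow> F\<^sub>k\<close>, exact at
  every \<open>F\<^sub>k\<close> with \<open>k \<ge> 1\<close>; that is, a free resolution of the cokernel of \<open>d 0\<close>.\<close>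

definition free_resolution_seq ::
  "(nat \<Rightarrow> nat) \<Rightarrow> (nat \<Rightarrow> nat \<Rightarrow> nat \<Rightarrow> 'r::comm_ring_1) \<Rightarrow> bool" where
  "free_resolution_seq r d \<longleftrightarrow>
     (\<forall>k. mat_app (r (k+1)) (r (k+2)) (d (k+1)) ` free_mod (r (k+2)) =
          {v \<in> free_mod (r (k+1)). mat_app (r k) (r (k+1)) (d k) v = (\<lambda>_. 0)})"

text \<open>A Noetherian ring is Gorenstein if its localization at each maximal ideal \<open>P\<close> has finite
  injective dimension over itself. Over a Noetherian local ring \<open>S\<close>, the injective dimension of
  \<open>S\<close> is at most \<open>n\<close> iff \<open>Ext\<^sup>i(N, S) = 0\<close> for all \<open>i > n\<close> and all finitely generated \<open>N\<close>. For
  \<open>S\<close> the localization of \<open>R\<close> at \<open>P\<close>, these are the localizations at \<open>P\<close> of the cohomology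
  modules of the duals of free resolutions \<open>(r, d)\<close> over \<open>R\<close>; an element of such a module is
  zero in the localization iff it is killed by some \<open>s \<notin> P\<close>. If \<open>R\<close> is local and \<open>P\<close> is its
  maximal ideal, then \<open>s\<close> is a unit.\<close>

definition gorenstein_ring :: "'r::comm_ring_1 itself \<Rightarrow> bool" where
  "gorenstein_ring _ \<longleftrightarrow> noetherian_ring TYPE('r) \<and>
     (\<forall>P :: 'r set. maximal_ring_ideal P \<longrightarrow>
       (\<exists>n. \<forall>r. \<forall>d :: nat \<Rightarrow> nat \<Rightarrow> nat \<Rightarrow> 'r. free_resolution_seq r d \<longrightarrow>
         (\<forall>k\<ge>n. \<forall>z\<in>free_mod (r (k+1)).
            mat_app (r (k+2)) (r (k+1)) (\<lambda>i j. d (k+1) j i) z = (\<lambda>_. 0) \<longrightarrow>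
            (\<exists>s. s \<notin> P \<and> (\<exists>y\<in>free_mod (r k).
               (\<lambda>i. s * z i) = mat_app (r (k+1)) (r k) (\<lambda>i j. d k j i) y)))))"

definition prime_height :: "'r::comm_ring_1 set \<Rightarrow> enat" where
  "prime_height P = Sup {enat n |n. \<exists>C :: nat \<Rightarrow> 'r set.
     (\<forall>i\<le>n. prime_ring_ideal (C i)) \<and> (\<forall>i<n. C i \<subset> C (Suc i)) \<and> C n = P}"

definition ideal_height :: "'r::comm_ring_1 set \<Rightarrow> enat" where
  "ideal_height I = (INF P\<in>{P. prime_ring_ideal P \<and> I \<subseteq> P}. prime_height P)"

definition regular_sequence :: "'r::comm_ring_1 list \<Rightarrow> bool" where
  "regular_sequence ps \<longleftrightarrow>
     ideal_gen (set ps) \<noteq> UNIV \<and>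
     (\<forall>i<length ps. \<forall>r. r * ps ! i \<in> ideal_gen (set (take i ps)) \<longrightarrow>
        r \<in> ideal_gen (set (take i ps)))"

definition ideal_grade :: "'r::comm_ring_1 set \<Rightarrow> enat" where
  "ideal_grade I = Sup {enat (length ps) |ps. regular_sequence ps \<and> set ps \<subseteq> I}"

text \<open>The projective dimension of \<open>R/I\<close>, computed with free modules of finite rank. Over
  a Noetherian ring that is local, or graded with \<open>I\<close> homogeneous, this gives the same number as
  projective resolutions.\<close>

definition proj_dim_quotient :: "'r::comm_ring_1 set \<Rightarrow> enat" where
  "proj_dim_quotient I = Inf {enat n |n. \<exists>r. \<exists>d :: nat \<Rightarrow> nat \<Rightarrow> nat \<Rightarrow> 'r.
     free_resolution_seq r d \<and> r 0 = 1 \<and>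
     (\<lambda>v. mat_app 1 (r 1) (d 0) v 0) ` free_mod (r 1) = I \<and> (\<forall>k>n. r k = 0)}"

definition perfect_ideal :: "'r::comm_ring_1 set \<Rightarrow> bool" where
  "perfect_ideal I \<longleftrightarrow> ring_ideal I \<and> I \<noteq> UNIV \<and> ideal_grade I = proj_dim_quotient I"


section \<open>Free modules, tensor and exterior powers in coordinates\<close>

text \<open>A free module with a basis indexed by \<open>'n\<close> is \<open>'r ^ 'n\<close>, and so is its dual, with the dual
  basis; \<open>axis i 1\<close> is the basis vector with index \<open>i\<close> in either of them. The dual of the map with
  matrix \<open>A\<close> has matrix \<open>transpose A\<close>. Tensor products are free on pairs of basis vectors.\<close>

definition pairing :: "'r::comm_ring_1 ^ 'n \<Rightarrow> 'r ^ 'n \<Rightarrow> 'r" where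
  "pairing v \<xi> = (\<Sum>i\<in>UNIV. v $ i * \<xi> $ i)"

definition tensor :: "'r::comm_ring_1 ^ 'a \<Rightarrow> 'r ^ 'b \<Rightarrow> 'r ^ ('a \<times> 'b)" where
  "tensor v w = vec_lambda (\<lambda>(i, j). v $ i * w $ j)"

text \<open>\<open>\<phi> \<otimes> id\<close> and \<open>id \<otimes> \<phi>\<close>, for linear \<open>\<phi>\<close>.\<close>

definition map_fst ::
  "('r::comm_ring_1 ^ 'a \<Rightarrow> 'r ^ 'c) \<Rightarrow> 'r ^ ('a \<times> 'b::finite) \<Rightarrow> 'r ^ ('c \<times> 'b)" where
  "map_fst \<phi> X = vec_lambda (\<lambda>(i, k). \<phi> (\<chi> j. X $ (j, k)) $ i)"

definition map_snd ::
  "('r::comm_ring_1 ^ 'b \<Rightarrow> 'r ^ 'c) \<Rightarrow> 'r ^ ('a::finite \<times> 'b) \<Rightarrow> 'r ^ ('a \<times> 'c)" where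
  "map_snd \<phi> X = vec_lambda (\<lambda>(i, k). \<phi> (\<chi> j. X $ (i, j)) $ k)"

text \<open>\<open>\<And>\<^sup>2F\<close> is identified with the alternating tensors in \<open>F \<otimes> F\<close> through
  \<open>v \<and> w \<mapsto> v \<otimes> w - w \<otimes> v\<close>: the coefficient of \<open>\<omega>\<close> at \<open>(u, v)\<close> is the value of
  \<open>\<omega>\<close> on \<open>\<gamma>\<^sub>u \<and> \<gamma>\<^sub>v\<close>. In particular \<open>\<omega>\<close> is the sum of \<open>\<omega> $ (u, v)\<close> times
  \<open>g\<^sub>u \<and> g\<^sub>v\<close> over the two-element subsets \<open>{u, v}\<close>. Likewise for \<open>\<And>\<^sup>3F\<close>.\<close>

definition ext2 :: "('r::comm_ring_1 ^ ('n::finite \<times> 'n)) set" where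
  "ext2 = {\<omega>. (\<forall>u. \<omega> $ (u, u) = 0) \<and> (\<forall>u v. \<omega> $ (v, u) = - \<omega> $ (u, v))}"

definition ext3 :: "('r::comm_ring_1 ^ (('n::finite \<times> 'n) \<times> 'n)) set" where
  "ext3 = {\<theta>. (\<forall>u v. \<theta> $ ((u, u), v) = 0) \<and>
              (\<forall>u v t. \<theta> $ ((v, u), t) = - \<theta> $ ((u, v), t)) \<and>
              (\<forall>u v t. \<theta> $ ((u, t), v) = - \<theta> $ ((u, v), t))}"

definition wedge :: "'r::comm_ring_1 ^ 'n \<Rightarrow> 'r ^ 'n \<Rightarrow> 'r ^ ('n \<times> 'n)" where
  "wedge v w = tensor v w - tensor w v"

text \<open>The values of \<open>\<omega> \<in> \<And>\<^sup>2F\<close> on \<open>\<xi> \<and> \<eta>\<close> and of \<open>\<theta> \<in> \<And>\<^sup>3F\<close> on \<open>\<xi> \<and> \<eta> \<and> \<zeta>\<close>. On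
  \<open>v \<and> w\<close> the former is the determinant of pairings, without a factor \<open>1/2\<close>, because the sum
  runs over ordered pairs of indices.\<close>

definition pairing2 :: "'r::comm_ring_1 ^ ('n \<times> 'n) \<Rightarrow> 'r ^ 'n \<Rightarrow> 'r ^ 'n \<Rightarrow> 'r" where
  "pairing2 \<omega> \<xi> \<eta> = pairing \<omega> (tensor \<xi> \<eta>)"

definition pairing3 ::
  "'r::comm_ring_1 ^ (('n \<times> 'n) \<times> 'n) \<Rightarrow> 'r ^ 'n \<Rightarrow> 'r ^ 'n \<Rightarrow> 'r ^ 'n \<Rightarrow> 'r" where
  "pairing3 \<theta> \<xi> \<eta> \<zeta> = pairing \<theta> (tensor (tensor \<xi> \<eta>) \<zeta>)"

text \<open>Since the kernel of \<open>F \<otimes> F \<rightarrow> S\<^sub>2F\<close> is generated by the tensors \<open>v \<otimes> w - w \<otimes> v\<close>, two tensors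
  have the same image in \<open>S\<^sub>2F\<close> iff their difference lies in \<^const>\<open>ext2\<close>. The second
  definition is the analogue for \<open>E \<otimes> F \<otimes> F \<rightarrow> E \<otimes> S\<^sub>2F\<close>.\<close>

definition eq_sym2 :: "'r::comm_ring_1 ^ ('n::finite \<times> 'n) \<Rightarrow> 'r ^ ('n \<times> 'n) \<Rightarrow> bool" where
  "eq_sym2 X Y \<longleftrightarrow> X - Y \<in> ext2"

definition eq_tensor_sym2 ::
  "'r::comm_ring_1 ^ (('l::finite \<times> 'n::finite) \<times> 'n) \<Rightarrow> 'r ^ (('l \<times> 'n) \<times> 'n) \<Rightarrow> bool" where
  "eq_tensor_sym2 X Y \<longleftrightarrow>
     (\<forall>u. eq_sym2 (vec_lambda (\<lambda>(h, k). X $ ((u, h), k)))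
                  (vec_lambda (\<lambda>(h, k). Y $ ((u, h), k))))"

text \<open>Linear maps out of \<open>\<And>\<^sup>kF\<close> are alternating \<open>k\<close>-linear maps, here functions of a list of
  length \<open>k\<close>.\<close>

abbreviation lin_map :: "('r::comm_ring_1 ^ 'n \<Rightarrow> 'r ^ 'm) \<Rightarrow> bool" where
  "lin_map \<equiv> module_hom (*s) (*s)"

definition ext_map :: "nat \<Rightarrow> (('r::comm_ring_1 ^ 'n) list \<Rightarrow> 'r ^ 'm) \<Rightarrow> bool" where
  "ext_map k f \<longleftrightarrow> (\<forall>vs. length vs = k \<longrightarrow>
     (\<forall>i<k. lin_map (\<lambda>v. f (vs[i := v]))) \<and>
     (\<forall>i<k. \<forall>j<k. i \<noteq> j \<and> vs ! i = vs ! j \<longrightarrow> f vs = 0))"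

text \<open>The list with its entry at position \<open>i\<close> omitted. Positions count from 0, so that the signs
  \<open>(-1)\<^sup>i\<^sup>+\<^sup>1\<close> for counting from 1 become \<open>(-1)\<^sup>i\<close>.\<close>

definition omit :: "nat \<Rightarrow> 'a list \<Rightarrow> 'a list" where
  "omit i xs = take i xs @ drop (Suc i) xs"

text \<open>The inverse of an invertible element.\<close>

definition ring_inv :: "'r::comm_ring_1 \<Rightarrow> 'r" where
  "ring_inv r = (THE s. r * s = 1)"


section \<open>Resolutions of length three\<close>

text \<open>In a complex \<open>0 \<rightarrow> A\<^sub>3 \<rightarrow> A\<^sub>2 \<rightarrow> A\<^sub>1 \<rightarrow> R\<close> the last map \<open>a\<^sub>1\<close> is \<open>pairing x\<close>, where \<open>x $ i = a\<^sub>1(e\<^sub>i)\<close>,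
  and the others are given by matrices.\<close>

definition free_resolution3 ::
  "'r::comm_ring_1 set \<Rightarrow> 'r ^ 'n \<Rightarrow> 'r ^ 'm ^ 'n \<Rightarrow> 'r ^ 'l ^ 'm \<Rightarrow> bool" where
  "free_resolution3 I x a2 a3 \<longleftrightarrow>
     range (pairing x) = I \<and>
     range ((*v) a2) = {e. pairing x e = 0} \<and>
     range ((*v) a3) = {f. a2 *v f = 0} \<and>
     inj ((*v) a3)"

definition minimal_complex3 ::
  "'r::comm_ring_1 set \<Rightarrow> 'r ^ 'n \<Rightarrow> 'r ^ 'm ^ 'n \<Rightarrow> 'r ^ 'l ^ 'm \<Rightarrow> bool" where
  "minimal_complex3 M x a2 a3 \<longleftrightarrow>
     (\<forall>i. x $ i \<in> M) \<and> (\<forall>i h. a2 $ i $ h \<in> M) \<and> (\<forall>h u. a3 $ h $ u \<in> M)"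

text \<open>The differentials are homogeneous of degree 0 for suitable degrees of the basis vectors.\<close>

definition graded_complex3 ::
  "(nat \<Rightarrow> 'r::comm_ring_1 set) \<Rightarrow> 'r ^ 'n \<Rightarrow> 'r ^ 'm ^ 'n \<Rightarrow> 'r ^ 'l ^ 'm \<Rightarrow> bool" where
  "graded_complex3 G x a2 a3 \<longleftrightarrow>
     (\<exists>(p :: 'n \<Rightarrow> nat) (q :: 'm \<Rightarrow> nat) (s :: 'l \<Rightarrow> nat).
        (\<forall>i. x $ i \<in> G (p i)) \<and>
        (\<forall>i h. if p i \<le> q h then a2 $ i $ h \<in> G (q h - p i) else a2 $ i $ h = 0) \<and>
        (\<forall>h u. if q h \<le> s u then a3 $ h $ u \<in> G (s u - q h) else a3 $ h $ u = 0))"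


section \<open>Structure maps\<close>

text \<open>The map \<open>w\<^sup>(\<^sup>k\<^sup>)\<^sub>t\<close> is called \<open>w<k>_<t>\<close>. Scalar factors such as \<open>(-1) ^ i\<close> have the type of the
  base ring. Tensor factors from \<open>A\<^sub>3\<close> are always written before those from \<open>A\<^sub>2\<close>.

  With the above identifications, the maps \<open>\<And>\<^sup>2A\<^sub>3 \<rightarrow> A\<^sub>3 \<otimes> A\<^sub>2\<close> and \<open>\<And>\<^sup>3A\<^sub>3 \<rightarrow> \<And>\<^sup>2A\<^sub>3 \<otimes> A\<^sub>2\<close> induced
  by \<open>a\<^sub>3\<close> (comultiplication, then \<open>a\<^sub>3\<close> on the last factor; e.g.
  \<open>v \<and> w \<mapsto> v \<otimes> a\<^sub>3(w) - w \<otimes> a\<^sub>3(v)\<close>) are both \<open>map_snd ((*v) a3)\<close>.\<close>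

definition is_w3_1 ::
  "'r::comm_ring_1 ^ 'n \<Rightarrow> 'r ^ 'm ^ 'n \<Rightarrow> (('r ^ 'n) list \<Rightarrow> 'r ^ 'm) \<Rightarrow> bool" where
  "is_w3_1 x a2 w3_1 \<longleftrightarrow> ext_map 2 w3_1 \<and>
     (\<forall>e e'. a2 *v w3_1 [e, e'] = pairing x e *s e' - pairing x e' *s e)"

definition is_w2_1 ::
  "'r::comm_ring_1 ^ 'n \<Rightarrow> 'r ^ 'm ^ 'n \<Rightarrow> 'r ^ 'l ^ 'm \<Rightarrow>
   (('r ^ 'n) list \<Rightarrow> 'r ^ 'm) \<Rightarrow> ('r ^ 'n \<Rightarrow> 'r ^ 'm \<Rightarrow> 'r ^ 'l) \<Rightarrow> bool" where
  "is_w2_1 x a2 a3 w3_1 w2_1 \<longleftrightarrow>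
     (\<forall>f. lin_map (\<lambda>e. w2_1 e f)) \<and> (\<forall>e. lin_map (w2_1 e)) \<and>
     (\<forall>e f. a3 *v w2_1 e f = pairing x e *s f - w3_1 [e, a2 *v f])"

definition is_w1_1 ::
  "'r::comm_ring_1 ^ 'n \<Rightarrow> 'r ^ 'l ^ 'm \<Rightarrow> (('r ^ 'n) list \<Rightarrow> 'r ^ 'm) \<Rightarrow>
   (('r ^ 'n) list \<Rightarrow> 'r ^ 'l) \<Rightarrow> bool" where
  "is_w1_1 x a3 w3_1 w1_1 \<longleftrightarrow> ext_map 3 w1_1 \<and>
     (\<forall>e e' e''. a3 *v w1_1 [e, e', e''] =
        pairing x e *s w3_1 [e', e''] - pairing x e' *s w3_1 [e, e''] +
        pairing x e'' *s w3_1 [e, e'])"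

definition is_w3_2 ::
  "'r::comm_ring_1 ^ 'l ^ 'm \<Rightarrow> (('r ^ 'n) list \<Rightarrow> 'r ^ 'm) \<Rightarrow>
   (('r ^ 'n) list \<Rightarrow> 'r ^ ('l \<times> 'm)) \<Rightarrow> bool" where
  "is_w3_2 a3 w3_1 w3_2 \<longleftrightarrow> ext_map 4 w3_2 \<and>
     (\<forall>e1 e2 e3 e4. eq_sym2 (map_fst ((*v) a3) (w3_2 [e1, e2, e3, e4]))
        (tensor (w3_1 [e1, e2]) (w3_1 [e3, e4]) - tensor (w3_1 [e1, e3]) (w3_1 [e2, e4]) +
         tensor (w3_1 [e1, e4]) (w3_1 [e2, e3])))"

text \<open>Signs: the image of \<open>e\<^sub>1\<cdot>e\<^sub>2 \<otimes> e\<^sub>3\<cdot>f - e\<^sub>1\<cdot>e\<^sub>3 \<otimes> e\<^sub>2\<cdot>f + e\<^sub>2\<cdot>e\<^sub>3 \<otimes> e\<^sub>1\<cdot>f\<close> in \<open>S\<^sub>2A\<^sub>2\<close> is the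
  difference of \<open>f a\<^sub>3(e\<^sub>1\<cdot>e\<^sub>2\<cdot>e\<^sub>3)\<close> and the image of \<open>w3_2 [e1, e2, e3, a2 *v f]\<close>, by the rule for
  \<open>a\<^sub>3(e\<cdot>f)\<close> in \<^const>\<open>is_w2_1\<close>. The right-hand side below lies in the kernel, as required for
  a lift to \<open>\<And>\<^sup>2A\<^sub>3\<close> to exist, only with the signs given here to the last two terms.\<close>

definition is_w2_2 ::
  "'r::comm_ring_1 ^ 'm ^ 'n \<Rightarrow> 'r ^ 'l ^ 'm \<Rightarrow> (('r ^ 'n) list \<Rightarrow> 'r ^ 'm) \<Rightarrow>
   ('r ^ 'n \<Rightarrow> 'r ^ 'm \<Rightarrow> 'r ^ 'l) \<Rightarrow> (('r ^ 'n) list \<Rightarrow> 'r ^ 'l) \<Rightarrow>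
   (('r ^ 'n) list \<Rightarrow> 'r ^ ('l \<times> 'm)) \<Rightarrow>
   (('r ^ 'n) list \<Rightarrow> 'r ^ 'm \<Rightarrow> 'r ^ ('l \<times> 'l)) \<Rightarrow> bool" where
  "is_w2_2 a2 a3 w3_1 w2_1 w1_1 w3_2 w2_2 \<longleftrightarrow>
     (\<forall>f. ext_map 3 (\<lambda>es. w2_2 es f)) \<and>
     (\<forall>e1 e2 e3. lin_map (w2_2 [e1, e2, e3])) \<and>
     (\<forall>e1 e2 e3 f. w2_2 [e1, e2, e3] f \<in> ext2 \<and>
        map_snd ((*v) a3) (w2_2 [e1, e2, e3] f) =
          tensor (w2_1 e3 f) (w3_1 [e1, e2]) - tensor (w2_1 e2 f) (w3_1 [e1, e3]) +
          tensor (w2_1 e1 f) (w3_1 [e2, e3]) + w3_2 [e1, e2, e3, a2 *v f] -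
          tensor (w1_1 [e1, e2, e3]) f)"

text \<open>Here \<open>map_fst (map_snd ((*v) a3))\<close>, with values taken modulo the alternating tensors
  in \<open>A\<^sub>2 \<otimes> A\<^sub>2\<close>, is the map \<open>\<And>\<^sup>2A\<^sub>3 \<otimes> A\<^sub>2 \<rightarrow> A\<^sub>3 \<otimes> S\<^sub>2A\<^sub>2\<close> induced by \<open>a\<^sub>3\<close>.\<close>

definition is_w3_31 ::
  "'r::comm_ring_1 ^ 'l ^ 'm \<Rightarrow> (('r ^ 'n) list \<Rightarrow> 'r ^ 'm) \<Rightarrow>
   (('r ^ 'n) list \<Rightarrow> 'r ^ ('l \<times> 'm)) \<Rightarrow>
   (('r ^ 'n) list \<Rightarrow> 'r ^ 'n \<Rightarrow> 'r ^ (('l \<times> 'l) \<times> 'm)) \<Rightarrow> bool" where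
  "is_w3_31 a3 w3_1 w3_2 w3_31 \<longleftrightarrow>
     (\<forall>e. ext_map 5 (\<lambda>es. w3_31 es e)) \<and>
     (\<forall>es. length es = 5 \<longrightarrow> lin_map (w3_31 es)) \<and>
     (\<forall>es e. length es = 5 \<longrightarrow>
        (\<forall>h. (\<chi> uv. w3_31 es e $ (uv, h)) \<in> ext2) \<and>
        eq_tensor_sym2 (map_fst (map_snd ((*v) a3)) (w3_31 es e))
          ((\<Sum>i<5. (- 1) ^ i *s tensor (w3_2 (omit i es)) (w3_1 [es ! i, e])) +
           ring_inv 2 *s (\<Sum>j<5. \<Sum>i<j. (- 1) ^ (i + j) *s
              tensor (w3_2 (omit i (omit j es) @ [e])) (w3_1 [es ! i, es ! j]))))"

definition is_w1_21 ::
  "'r::comm_ring_1 ^ 'n \<Rightarrow> 'r ^ 'l ^ 'm \<Rightarrow> (('r ^ 'n) list \<Rightarrow> 'r ^ 'm) \<Rightarrow>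
   (('r ^ 'n) list \<Rightarrow> 'r ^ 'l) \<Rightarrow> (('r ^ 'n) list \<Rightarrow> 'r ^ ('l \<times> 'm)) \<Rightarrow>
   (('r ^ 'n) list \<Rightarrow> 'r ^ 'n \<Rightarrow> 'r ^ ('l \<times> 'l)) \<Rightarrow> bool" where
  "is_w1_21 x a3 w3_1 w1_1 w3_2 w1_21 \<longleftrightarrow>
     (\<forall>e. ext_map 4 (\<lambda>es. w1_21 es e)) \<and>
     (\<forall>es. length es = 4 \<longrightarrow> lin_map (w1_21 es)) \<and>
     (\<forall>es e. length es = 4 \<longrightarrow> w1_21 es e \<in> ext2 \<and>
        map_snd ((*v) a3) (w1_21 es e) =
          (\<Sum>i<4. (- 1) ^ i *s tensor (w1_1 (omit i es)) (w3_1 [es ! i, e])) +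
          (\<Sum>i<4. (- 1) ^ i *s (pairing x (es ! i) *s w3_2 (omit i es @ [e]))))"

text \<open>In the second sum the triple product is wedged from the left with the \<open>A\<^sub>3\<close>-factor of
  \<open>w3_2\<close>. With this order and with the coefficient \<open>2/3\<close> of the third sum, the right-hand side
  lies in the kernel of \<open>\<And>\<^sup>2A\<^sub>3 \<otimes> A\<^sub>2 \<rightarrow> A\<^sub>3 \<otimes> S\<^sub>2A\<^sub>2\<close>, as required for a lift to exist: the images
  of the terms of the third sum containing a given \<open>a\<^sub>1(e\<^sub>i)\<close> add up, without the coefficient,
  to \<open>3/2\<close> times those of the first two sums. For \<open>es = [e, s\<^sub>1, s\<^sub>2, s\<^sub>3]\<close> and
  \<open>hs = [s\<^sub>1, s\<^sub>2, s\<^sub>3]\<close> the third sum vanishes, since \<open>w3_31\<close> is alternating.\<close>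

definition is_w1_31 ::
  "'r::comm_ring_1 ^ 'n \<Rightarrow> 'r ^ 'l ^ 'm \<Rightarrow> (('r ^ 'n) list \<Rightarrow> 'r ^ 'm) \<Rightarrow>
   (('r ^ 'n) list \<Rightarrow> 'r ^ 'l) \<Rightarrow> (('r ^ 'n) list \<Rightarrow> 'r ^ ('l \<times> 'm)) \<Rightarrow>
   (('r ^ 'n) list \<Rightarrow> 'r ^ 'n \<Rightarrow> 'r ^ (('l \<times> 'l) \<times> 'm)) \<Rightarrow>
   (('r ^ 'n) list \<Rightarrow> 'r ^ 'n \<Rightarrow> 'r ^ ('l \<times> 'l)) \<Rightarrow>
   (('r ^ 'n) list \<Rightarrow> ('r ^ 'n) list \<Rightarrow> 'r ^ (('l \<times> 'l) \<times> 'l)) \<Rightarrow> bool" where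
  "is_w1_31 x a3 w3_1 w1_1 w3_2 w3_31 w1_21 w1_31 \<longleftrightarrow>
     (\<forall>hs. length hs = 3 \<longrightarrow> ext_map 4 (\<lambda>es. w1_31 es hs)) \<and>
     (\<forall>es. length es = 4 \<longrightarrow> ext_map 3 (w1_31 es)) \<and>
     (\<forall>es hs. length es = 4 \<and> length hs = 3 \<longrightarrow> w1_31 es hs \<in> ext3 \<and>
        map_snd ((*v) a3) (w1_31 es hs) =
          (\<Sum>i<3. (- 1) ^ i *s tensor (w1_21 es (hs ! i)) (w3_1 (omit i hs))) +
          (\<Sum>i<4. (- 1) ^ i *s
             map_fst (wedge (w1_1 (omit i es))) (w3_2 (hs @ [es ! i]))) -
          (2 * ring_inv 3) *s (\<Sum>i<4. \<Sum>j<3. (- 1) ^ (i + j) *s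
             (pairing x (es ! i) *s w3_31 (omit i es @ omit j hs) (hs ! j))))"


section \<open>The mapping cone and its multiplication\<close>

text \<open>\<open>B\<^sub>1\<close> and \<open>B\<^sub>2\<close> are \<open>'r ^ 3\<close>, with indices \<open>1, 2, 3\<close>. The matrix \<open>U\<close> has entries
  \<open>U $ i $ j = u\<^sub>i\<^sub>j\<close>, so \<open>\<alpha>\<^sub>1(s\<^sub>j)\<close> is its \<open>j\<close>-th column. Direct sums are indexed by sum types.\<close>

definition alpha1 :: "'r::comm_ring_1 ^ 3 ^ 'n \<Rightarrow> 3 \<Rightarrow> 'r ^ 'n" where
  "alpha1 U j = column j U"

definition eps_s :: "'r::comm_ring_1 ^ 3 ^ 'n \<Rightarrow> ('r ^ 'n) list" where
  "eps_s U = [alpha1 U 1, alpha1 U 2, alpha1 U 3]"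

text \<open>The elements \<open>b\<^sub>1(s\<^sub>j)\<close>, which are the generators of the ideal of the regular sequence.\<close>

definition kos :: "'r::comm_ring_1 ^ 'n \<Rightarrow> 'r ^ 3 ^ 'n \<Rightarrow> 'r ^ 3" where
  "kos x U = (\<chi> j. \<Sum>i\<in>UNIV. U $ i $ j * x $ i)"

text \<open>\<open>b\<^sub>2\<close> is determined by \<open>b\<^sub>2(s\<^sub>i\<cdot>s\<^sub>j) = b\<^sub>1(s\<^sub>i)s\<^sub>j - b\<^sub>1(s\<^sub>j)s\<^sub>i\<close> and \<open>s\<^sub>2\<cdot>s\<^sub>3 = t\<^sub>1\<close>,
  \<open>s\<^sub>1\<cdot>s\<^sub>3 = -t\<^sub>2\<close>, \<open>s\<^sub>1\<cdot>s\<^sub>2 = t\<^sub>3\<close>.\<close>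

definition koszul_b2 :: "'r::comm_ring_1 ^ 3 \<Rightarrow> 'r ^ 3 \<Rightarrow> 'r ^ 3" where
  "koszul_b2 p t = vector
     [p $ 3 * t $ 2 - p $ 2 * t $ 3, p $ 1 * t $ 3 - p $ 3 * t $ 1, p $ 2 * t $ 1 - p $ 1 * t $ 2]"

definition beta1 :: "'r::comm_ring_1 ^ 3 ^ 'n \<Rightarrow> 'r ^ 'n \<Rightarrow> 'r ^ 3" where
  "beta1 U \<xi> = transpose U *v \<xi>"

definition beta2 ::
  "'r::comm_ring_1 ^ 3 ^ 'n \<Rightarrow> (('r ^ 'n) list \<Rightarrow> 'r ^ 'm) \<Rightarrow> 'r ^ 'm \<Rightarrow> 'r ^ 3" where
  "beta2 U w3_1 \<phi> = vector
     [  pairing (w3_1 [alpha1 U 2, alpha1 U 3]) \<phi>,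
      - pairing (w3_1 [alpha1 U 1, alpha1 U 3]) \<phi>,
        pairing (w3_1 [alpha1 U 1, alpha1 U 2]) \<phi>]"

definition beta3 ::
  "'r::comm_ring_1 ^ 3 ^ 'n \<Rightarrow> (('r ^ 'n) list \<Rightarrow> 'r ^ 'l) \<Rightarrow> 'r ^ 'l \<Rightarrow> 'r" where
  "beta3 U w1_1 \<gamma> = pairing (w1_1 (eps_s U)) \<gamma>"

definition dsum :: "'r ^ 'a \<Rightarrow> 'r ^ 'b \<Rightarrow> 'r ^ ('a + 'b)" where
  "dsum v w = vec_lambda (case_sum (\<lambda>i. v $ i) (\<lambda>j. w $ j))"

definition dsum_fst :: "'r ^ ('a + 'b::finite) \<Rightarrow> 'r ^ 'a" where
  "dsum_fst y = (\<chi> i. y $ Inl i)"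

definition dsum_snd :: "'r ^ ('a::finite + 'b) \<Rightarrow> 'r ^ 'b" where
  "dsum_snd y = (\<chi> j. y $ Inr j)"

text \<open>The differentials of the complex
  \<open>0 \<rightarrow> A\<^sub>1\<^sup>* \<rightarrow> A\<^sub>2\<^sup>* \<oplus> B\<^sub>2 \<rightarrow> A\<^sub>3\<^sup>* \<oplus> B\<^sub>1 \<rightarrow> R\<close>.\<close>

definition cone_d1 ::
  "'r::comm_ring_1 ^ 'n \<Rightarrow> 'r ^ 3 ^ 'n \<Rightarrow> (('r ^ 'n) list \<Rightarrow> 'r ^ 'l) \<Rightarrow>
   'r ^ ('l + 3) \<Rightarrow> 'r" where
  "cone_d1 x U w1_1 y = beta3 U w1_1 (dsum_fst y) + pairing (kos x U) (dsum_snd y)"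

definition cone_d2 ::
  "'r::comm_ring_1 ^ 'n \<Rightarrow> 'r ^ 'l ^ 'm \<Rightarrow> 'r ^ 3 ^ 'n \<Rightarrow>
   (('r ^ 'n) list \<Rightarrow> 'r ^ 'm) \<Rightarrow> 'r ^ ('m + 3) \<Rightarrow> 'r ^ ('l + 3)" where
  "cone_d2 x a3 U w3_1 y =
     dsum (transpose a3 *v dsum_fst y)
          (- beta2 U w3_1 (dsum_fst y) - koszul_b2 (kos x U) (dsum_snd y))"

definition cone_d3 ::
  "'r::comm_ring_1 ^ 'm ^ 'n \<Rightarrow> 'r ^ 3 ^ 'n \<Rightarrow> 'r ^ 'n \<Rightarrow> 'r ^ ('m + 3)" where
  "cone_d3 a2 U \<xi> = dsum (transpose a2 *v \<xi>) (beta1 U \<xi>)"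

definition gam :: "'l::finite \<Rightarrow> 'r::comm_ring_1 ^ ('l + 3)" where
  "gam t = dsum (axis t 1) 0"

definition ess :: "3 \<Rightarrow> 'r::comm_ring_1 ^ ('l::finite + 3)" where
  "ess j = dsum 0 (axis j 1)"

text \<open>The multiplication \<open>\<And>\<^sup>2D\<^sub>1 \<rightarrow> D\<^sub>2\<close>, given on basis elements. The signs satisfy
  \<open>d\<^sub>2(y\<cdot>z) = d\<^sub>1(z)y - d\<^sub>1(y)z\<close> throughout, which is what makes
  \<open>d\<^sub>1(x) y\<cdot>z - d\<^sub>1(y) x\<cdot>z + d\<^sub>1(z) x\<cdot>y\<close> a cycle; because of the entry \<open>-b\<^sub>2\<close> in \<open>d\<^sub>2\<close> this is the
  rule forced by \<open>s\<^sub>1\<cdot>s\<^sub>2 = t\<^sub>3\<close>. It requires the product of \<open>\<gamma>\<^sub>t\<close> and \<open>s\<^sub>j\<close> to be given, with a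
  positive sign, in this order.\<close>

definition is_mult2 ::
  "'r::comm_ring_1 ^ 3 ^ 'n \<Rightarrow> ('r ^ 'n \<Rightarrow> 'r ^ 'm \<Rightarrow> 'r ^ 'l) \<Rightarrow>
   (('r ^ 'n) list \<Rightarrow> 'r ^ 'm \<Rightarrow> 'r ^ ('l \<times> 'l)) \<Rightarrow>
   (('r ^ ('l + 3)) list \<Rightarrow> 'r ^ ('m + 3)) \<Rightarrow> bool" where
  "is_mult2 U w2_1 w2_2 \<mu>2 \<longleftrightarrow> ext_map 2 \<mu>2 \<and>
     \<mu>2 [ess 1, ess 2] = dsum 0 (axis 3 1) \<and>
     \<mu>2 [ess 1, ess 3] = - dsum 0 (axis 2 1) \<and>
     \<mu>2 [ess 2, ess 3] = dsum 0 (axis 1 1) \<and>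
     (\<forall>t j. \<mu>2 [gam t, ess j] =
        dsum (\<chi> h. pairing (w2_1 (alpha1 U j) (axis h 1)) (axis t 1)) 0) \<and>
     (\<forall>u t. \<mu>2 [gam u, gam t] =
        dsum (\<chi> h. pairing2 (w2_2 (eps_s U) (axis h 1)) (axis u 1) (axis t 1)) 0)"

definition is_mult3 ::
  "'r::comm_ring_1 ^ 'n \<Rightarrow> 'r ^ 'm ^ 'n \<Rightarrow> 'r ^ 3 ^ 'n \<Rightarrow> (('r ^ 'n) list \<Rightarrow> 'r ^ 'l) \<Rightarrow>
   (('r ^ ('l + 3)) list \<Rightarrow> 'r ^ ('m + 3)) \<Rightarrow> (('r ^ ('l + 3)) list \<Rightarrow> 'r ^ 'n) \<Rightarrow> bool" where
  "is_mult3 x a2 U w1_1 \<mu>2 \<mu>3 \<longleftrightarrow> ext_map 3 \<mu>3 \<and>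
     (\<forall>y z v. cone_d3 a2 U (\<mu>3 [y, z, v]) =
        cone_d1 x U w1_1 y *s \<mu>2 [z, v] - cone_d1 x U w1_1 z *s \<mu>2 [y, v] +
        cone_d1 x U w1_1 v *s \<mu>2 [y, z])"

end

theory Submission
  imports Defs
begin

text \<open>The map $d_3$ is injective, so each of the four formulas may be checked after applying $d_3$,
  where the left-hand side is given by the defining relation of the triple product. The right-hand
  sides are functionals \<open>e \<mapsto> F(e)\<close> on $A_1$, evaluated at the basis vectors, and $d_3 = (a_2^*, \beta_1)$
  turns such a functional into its values \<open>F(a\<^sub>2(f))\<close> on boundaries and \<open>F(\<alpha>\<^sub>1(s\<^sub>j))\<close> on the
  generators of the regular sequence (\<open>cone_d3_functional\<close>).

  The values \<open>F(\<alpha>\<^sub>1(s\<^sub>j))\<close> are immediate: with two or three factors \<open>\<gamma>\<close> they vanish, because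
  \<open>\<alpha>\<^sub>1(s\<^sub>j)\<close> then occurs twice among alternating arguments, and with one factor they reproduce the
  Koszul products $s_j\cdot s_k$. The values on boundaries carry the content. Writing \<open>\<epsilon>\<close> for
  $e_1\wedge e_2\wedge e_3$ and \<open>e\<close> for one of the $e_i$, they are
    $$(a_2 f)\cdot e\cdot e' = a_1(e')\,e\cdot f - a_1(e)\,e'\cdot f,$$
    $$w^{(1)}_{2,1}(a_2 f\wedge\epsilon\otimes e) = w^{(1)}_1(\epsilon)\wedge(e\cdot f) + a_1(e)\,w^{(2)}_2(\epsilon\otimes f),$$
    $$w^{(1)}_{3,1}(a_2 f\wedge\epsilon\otimes\epsilon) = w^{(1)}_1(\epsilon)\wedge w^{(2)}_2(\epsilon\otimes f)$$
  (\<open>w1_1_on_boundaries\<close>, \<open>w1_21_on_boundaries\<close>, \<open>w1_31_on_boundaries\<close>). Since $a_3$ is injective, it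
  suffices to compare both sides after applying $a_3$ to the last factor, where each structure map is
  known from its lifting property. Each identity uses the preceding ones, and $a_1a_2 = 0$ removes the
  terms with $a_1(a_2 f)$. Evaluated on products of the \<open>\<gamma>\<close>, the right-hand sides are exactly the
  $A_2^*$-components of the relations that define the triple products.\<close>


section \<open>Alternating maps\<close>

lemma ext_map_repeated:
  assumes "ext_map k f" "length vs = k" "\<not> distinct vs"
  shows "f vs = 0"
  using assms unfolding ext_map_def distinct_conv_nth by blast

lemma ext_map_swap:
  assumes f: "ext_map k f" and l: "length vs = k" and ij: "i < k" "j < k" "i \<noteq> j"
  shows "f (vs[i := vs ! j, j := vs ! i]) = - f vs"
proof -
  define g where "g a b = f (vs[i := a, j := b])" for a b
  have lin1: "lin_map (\<lambda>a. g a b)" for b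
  proof -
    have "lin_map (\<lambda>a. f ((vs[j := b])[i := a]))"
      using f l ij by (simp add: ext_map_def)
    thus ?thesis using ij by (simp add: g_def list_update_swap[of j i])
  qed
  have lin2: "lin_map (g a)" for a
  proof -
    have "lin_map (\<lambda>b. f ((vs[i := a])[j := b]))"
      using f l ij by (simp add: ext_map_def del: list_update.simps)
    thus ?thesis by (simp add: g_def[abs_def])
  qed
  have alt: "g a a = 0" for a
  proof -
    have "length (vs[i := a, j := a]) = k" "vs[i := a, j := a] ! i = vs[i := a, j := a] ! j"
      using l ij by simp_all
    thus ?thesis using f ij unfolding g_def ext_map_def by blast
  qed
  have "0 = g (vs ! i + vs ! j) (vs ! i + vs ! j)" by (simp add: alt)
  also have "\<dots> = g (vs ! i) (vs ! i + vs ! j) + g (vs ! j) (vs ! i + vs ! j)"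
    by (rule module_hom.add[OF lin1])
  also have "\<dots> = g (vs ! i) (vs ! j) + g (vs ! j) (vs ! i)"
    by (simp add: module_hom.add[OF lin2] alt)
  finally have "- g (vs ! i) (vs ! j) = g (vs ! j) (vs ! i)"
    by (intro minus_unique) (rule sym)
  thus ?thesis by (simp add: g_def)
qed

lemma ext_map_2_swap: "ext_map 2 f \<Longrightarrow> f [b, a] = - f [a, b]"
  using ext_map_swap[of 2 f "[a, b]" 0 1] by simp

lemma ext_map_3_swap:
  assumes "ext_map 3 f"
  shows "f [b, a, c] = - f [a, b, c]" "f [a, c, b] = - f [a, b, c]"
  using ext_map_swap[OF assms, of "[a, b, c]" 0 1] ext_map_swap[OF assms, of "[a, b, c]" 1 2]
  by simp_all

lemma ext_map_4_swap:
  assumes "ext_map 4 f"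
  shows "f [b, a, c, d] = - f [a, b, c, d]" "f [a, c, b, d] = - f [a, b, c, d]"
    "f [a, b, d, c] = - f [a, b, c, d]"
  using ext_map_swap[OF assms, of "[a, b, c, d]" 0 1] ext_map_swap[OF assms, of "[a, b, c, d]" 1 2]
    ext_map_swap[OF assms, of "[a, b, c, d]" 2 3]
  by (simp_all add: numeral_3_eq_3)

lemma ext_map_4_rotate:
  assumes "ext_map 4 f"
  shows "f [a, b, c, d] = - f [b, c, d, a]"
proof -
  have "f [b, c, d, a] = - f [b, c, a, d]" by (rule ext_map_4_swap(3)[OF assms])
  also have "f [b, c, a, d] = - f [b, a, c, d]" by (rule ext_map_4_swap(2)[OF assms])
  also have "f [b, a, c, d] = - f [a, b, c, d]" by (rule ext_map_4_swap(1)[OF assms])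
  finally show ?thesis by simp
qed

lemma ext_map_lin_hd:
  assumes "ext_map (Suc k) f" "length vs = k"
  shows "lin_map (\<lambda>v. f (v # vs))"
proof -
  have "lin_map (\<lambda>v. f ((0 # vs)[0 := v]))"
    using assms unfolding ext_map_def by (metis length_Cons zero_less_Suc)
  thus ?thesis by simp
qed

lemma ext_map_lin_last:
  assumes "ext_map (Suc k) f" "length vs = k"
  shows "lin_map (\<lambda>v. f (vs @ [v]))"
proof -
  have "lin_map (\<lambda>v. f ((vs @ [0])[k := v]))"
    using assms unfolding ext_map_def by (metis length_append_singleton lessI)
  thus ?thesis using assms(2) by (simp add: list_update_append)
qed


section \<open>Coordinates\<close>

lemma transpose_mult_functional:
  fixes A :: "'r::comm_ring_1 ^ 'm::finite ^ 'n::finite" and F :: "'r ^ 'n \<Rightarrow> 'r ^ 'k"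
  assumes "lin_map F"
  shows "(transpose A *v (\<chi> i. F (axis i 1) $ p)) $ h = F (column h A) $ p"
proof -
  have "column h A = (\<Sum>i\<in>UNIV. A $ i $ h *s axis i 1)"
    by (simp add: vec_eq_iff column_def axis_def if_distrib[of "\<lambda>z. _ * z"] cong: if_cong)
  thus ?thesis
    by (simp add: module_hom.sum[OF assms] module_hom.scale[OF assms]
        matrix_vector_mult_def transpose_def)
qed

lemma matrix_mult_axis: "A *v axis h (1::'r::comm_ring_1) = column h A"
  by (simp add: vec_eq_iff matrix_vector_mult_def column_def axis_def if_distrib[of "\<lambda>z. _ * z"] cong: if_cong)

lemma pairing_axis: "pairing v (axis t 1) = v $ t"
  by (simp add: pairing_def axis_def if_distrib[of "\<lambda>z. _ * z"] cong: if_cong)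

lemma pairing_axis_left: "pairing (axis t 1) v = v $ t"
  by (simp add: pairing_def axis_def if_distrib[of "\<lambda>z. z * _"] cong: if_cong)

lemma tensor_axis: "tensor (axis t 1) (axis u 1) = (axis (t, u) 1 :: 'r::comm_ring_1 ^ _)"
  by (simp add: vec_eq_iff tensor_def axis_def)

lemma matrix_mult_scale: "A *v (c *s v) = c *s (A *v (v :: 'r::comm_ring_1 ^ 'n::finite))"
  by (simp add: vec_eq_iff matrix_vector_mult_def sum_distrib_left mult.left_commute)

lemma map_snd_matrix:
  fixes A :: "'r::comm_ring_1 ^ 'm::finite ^ 'n::finite"
  shows "map_snd ((*v) A) (X + Y) = map_snd ((*v) A) X + map_snd ((*v) A) Y"
    "map_snd ((*v) A) (c *s X) = c *s map_snd ((*v) A) X"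
    "map_snd ((*v) A) (wedge v w) = tensor v (A *v w) - tensor w (A *v v)"
  by (auto simp: vec_eq_iff map_snd_def matrix_vector_mult_def wedge_def tensor_def algebra_simps
      sum.distrib sum_distrib_left sum_subtractf)

text \<open>By this cancellation an element of $\bigwedge^2A_3$ or $\bigwedge^3A_3$ is determined by its image
  in $A_3\otimes A_2$ or $\bigwedge^2A_3\otimes A_2$.\<close>

lemma map_snd_inj:
  assumes "inj \<phi>" "map_snd \<phi> X = map_snd \<phi> Y"
  shows "X = Y"
proof -
  have "\<phi> (\<chi> j. X $ (i, j)) = \<phi> (\<chi> j. Y $ (i, j))" for i
    using assms(2) by (auto simp: vec_eq_iff map_snd_def)
  hence "(\<chi> j. X $ (i, j)) = (\<chi> j. Y $ (i, j))" for i
    using assms(1) by (blast dest: injD)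
  thus ?thesis by (auto simp: vec_eq_iff)
qed


section \<open>The differentials of the mapping cone\<close>

lemma pairing_alpha1: "pairing x (alpha1 U j) = kos x U $ j"
  by (simp add: pairing_def alpha1_def column_def kos_def mult.commute)

text \<open>The last differential is injective because $p_1 = a_1(\alpha_1(s_1))$ is a nonzerodivisor. Write
  $\sigma = \alpha_1(s_1)$. Applying \<open>\<zeta>\<close> to $a_2(\sigma\cdot e) = p_1 e - a_1(e)\sigma$ gives
  $p_1\zeta(e) = (a_2^*\zeta)(\sigma\cdot e) + a_1(e)\,\zeta(\sigma)$, and both terms on the right only depend
  on the image of \<open>\<zeta>\<close> under the differential.\<close>

lemma cone_d3_inj:
  fixes x :: "'r::comm_ring_1 ^ 'n::finite" and a2 :: "'r ^ 'm::finite ^ 'n"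
  assumes w3_1: "is_w3_1 x a2 w3_1"
    and reg: "\<And>r. r * kos x U $ 1 = 0 \<Longrightarrow> r = 0"
    and eq: "cone_d3 a2 U \<xi> = cone_d3 a2 U \<eta>"
  shows "\<xi> = \<eta>"
proof -
  define \<zeta> where "\<zeta> = \<xi> - \<eta>"
  have "transpose a2 *v \<xi> = transpose a2 *v \<eta>" "transpose U *v \<xi> = transpose U *v \<eta>"
    using eq by (auto simp: cone_d3_def dsum_def beta1_def vec_eq_iff split: sum.splits
        dest: spec[of _ "Inl _"] spec[of _ "Inr _"])
  hence a: "transpose a2 *v \<zeta> = 0" and b: "transpose U *v \<zeta> = 0"
    by (simp_all add: \<zeta>_def matrix_vector_mult_diff_distrib)
  have tr: "pairing (A *v f) \<zeta> = pairing f (transpose A *v \<zeta>)" for A :: "'r ^ 'k::finite ^ 'n" and f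
    unfolding pairing_def matrix_vector_mult_def transpose_def
    by (simp add: sum_distrib_left sum_distrib_right mult_ac) (rule sum.swap)
  have s1: "alpha1 U 1 = U *v axis 1 1" by (simp add: alpha1_def matrix_mult_axis)
  have z1: "pairing (alpha1 U 1) \<zeta> = 0" unfolding s1 tr b by (simp add: pairing_def)
  have tr_a2: "pairing (a2 *v f) \<zeta> = 0" for f unfolding tr a by (simp add: pairing_def)
  have "\<zeta> $ i * kos x U $ 1 = 0" for i
  proof -
    have "a2 *v w3_1 [alpha1 U 1, axis i 1] =
      kos x U $ 1 *s axis i 1 - pairing x (axis i 1) *s alpha1 U 1"
      using w3_1 by (simp add: is_w3_1_def pairing_alpha1)
    hence "0 = pairing (kos x U $ 1 *s axis i 1 - pairing x (axis i 1) *s alpha1 U 1) \<zeta>"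
      by (metis tr_a2)
    also have "\<dots> = kos x U $ 1 * pairing (axis i 1) \<zeta> - pairing x (axis i 1) * pairing (alpha1 U 1) \<zeta>"
    proof -
      have "pairing (c *s v - d *s w) \<zeta> = c * pairing v \<zeta> - d * pairing w \<zeta>" for c d v w
        by (simp add: pairing_def algebra_simps sum_subtractf sum_distrib_left)
      thus ?thesis .
    qed
    also have "\<dots> = \<zeta> $ i * kos x U $ 1"
      by (simp add: z1 pairing_axis_left mult.commute)
    finally show ?thesis by simp
  qed
  hence "\<zeta> = 0" using reg by (simp add: vec_eq_iff)
  thus ?thesis by (simp add: \<zeta>_def)
qed

lemma cone_d3_functional:
  assumes "lin_map F"
  shows "cone_d3 a2 U (\<chi> i. F (axis i 1) $ p) =
    dsum (\<chi> h. F (a2 *v axis h 1) $ p) (\<chi> j. F (alpha1 U j) $ p)"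
  by (auto simp: cone_d3_def dsum_def beta1_def alpha1_def matrix_mult_axis vec_eq_iff
      transpose_mult_functional[OF assms] simp del: transpose_matrix_vector split: sum.splits)

lemma cone_d1_gam: "cone_d1 x U w1_1 (gam t) = w1_1 (eps_s U) $ t"
  by (simp add: cone_d1_def gam_def dsum_def dsum_fst_def dsum_snd_def beta3_def pairing_def axis_def
      if_distrib[of "\<lambda>z. _ * z"] cong: if_cong)

lemma cone_d1_ess: "cone_d1 x U w1_1 (ess j) = kos x U $ j"
  by (simp add: cone_d1_def ess_def dsum_def dsum_fst_def dsum_snd_def beta3_def pairing_def axis_def
      if_distrib[of "\<lambda>z. _ * z"] cong: if_cong)

text \<open>The element $w = \sum_i x_i\epsilon_i$ is $a_1$ itself, viewed as a functional.\<close>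

lemma cone_d3_generators:
  assumes "\<And>f. pairing x (a2 *v f) = 0"
  shows "cone_d3 a2 U x = dsum 0 (kos x U)"
proof -
  have "pairing x (column h a2) = 0" for h
    using assms[of "axis h 1"] by (simp add: matrix_mult_axis)
  thus ?thesis
    by (auto simp: cone_d3_def dsum_def beta1_def kos_def vec_eq_iff pairing_def
        column_def transpose_def matrix_vector_mult_def mult.commute split: sum.splits)
qed


section \<open>Structure maps on boundaries\<close>

text \<open>After applying $a_3$, the left-hand side is $-a_1(e)\,(a_2f)\cdot e' + a_1(e')\,(a_2f)\cdot e$, and the terms
  $a_1(e)a_1(e')f$ on the right cancel.\<close>

lemma w1_1_on_boundaries:
  assumes inj: "inj ((*v) a3)" and x_a2: "\<And>f. pairing x (a2 *v f) = 0"
    and w3_1: "is_w3_1 x a2 w3_1"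
    and w2_1: "is_w2_1 x a2 a3 w3_1 w2_1"
    and w1_1: "is_w1_1 x a3 w3_1 w1_1"
  shows "w1_1 [a2 *v f, e, e'] = pairing x e' *s w2_1 e f - pairing x e *s w2_1 e' f"
proof (rule injD[OF inj])
  have alt: "w3_1 [a2 *v f, e] = - w3_1 [e, a2 *v f]" for e
    by (rule ext_map_2_swap) (use w3_1 in \<open>simp add: is_w3_1_def\<close>)
  have c1: "a3 *v w2_1 e f = pairing x e *s f - w3_1 [e, a2 *v f]" for e
    using w2_1 by (simp add: is_w2_1_def)
  have c0: "a3 *v w1_1 [a2 *v f, e, e'] = pairing x (a2 *v f) *s w3_1 [e, e'] -
      pairing x e *s w3_1 [a2 *v f, e'] + pairing x e' *s w3_1 [a2 *v f, e]"
    using w1_1 by (simp add: is_w1_1_def)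
  show "a3 *v w1_1 [a2 *v f, e, e'] = a3 *v (pairing x e' *s w2_1 e f - pairing x e *s w2_1 e' f)"
    unfolding c0 matrix_vector_mult_diff_distrib matrix_mult_scale c1 x_a2 alt
    by (simp add: vec_eq_iff algebra_simps)
qed

text \<open>Because $a_1a_2 = 0$ and \<open>e\<close> is one of the $e_i$, only one term of the sum with $w^{(3)}_2$ survives, and it
  becomes the term with $w^{(3)}_2$ in the lifting property of $w^{(2)}_2$. In the sum with the triple
  products, the term without $a_2f$ is \<open>e\<^sub>1 \<cdot> e\<^sub>2 \<cdot> e\<^sub>3 \<otimes> (a\<^sub>2 f) \<cdot> e\<close>. It is the sum of
  \<open>e\<^sub>1 \<cdot> e\<^sub>2 \<cdot> e\<^sub>3 \<otimes> a\<^sub>3(e \<cdot> f)\<close>, from the wedge product, and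
  \<open>- a\<^sub>1(e) e\<^sub>1 \<cdot> e\<^sub>2 \<cdot> e\<^sub>3 \<otimes> f\<close>, from $w^{(2)}_2$. The other triple products contain $a_2f$, and
  \<open>w1_1_on_boundaries\<close> expresses them by the products \<open>e\<^sub>i \<cdot> f\<close>.\<close>

lemma w1_21_on_boundaries:
  assumes inj: "inj ((*v) a3)" and x_a2: "\<And>f. pairing x (a2 *v f) = 0"
    and w3_1: "is_w3_1 x a2 w3_1"
    and w2_1: "is_w2_1 x a2 a3 w3_1 w2_1"
    and w1_1: "is_w1_1 x a3 w3_1 w1_1"
    and w3_2: "is_w3_2 a3 w3_1 w3_2"
    and w2_2: "is_w2_2 a2 a3 w3_1 w2_1 w1_1 w3_2 w2_2"
    and w1_21: "is_w1_21 x a3 w3_1 w1_1 w3_2 w1_21"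
    and e: "e \<in> {e1, e2, e3}"
  shows "w1_21 [a2 *v f, e1, e2, e3] e =
    wedge (w1_1 [e1, e2, e3]) (w2_1 e f) + pairing x e *s w2_2 [e1, e2, e3] f"
proof (rule map_snd_inj[OF inj])
  have alt2: "ext_map 2 w3_1" and alt4: "ext_map 4 w3_2"
    using w3_1 w3_2 by (simp_all add: is_w3_1_def is_w3_2_def)
  have rep2: "w3_1 [a, a] = 0" for a
    by (rule ext_map_repeated[OF alt2]) simp_all
  have rep4: "w3_2 vs = 0" if "length vs = 4" "\<not> distinct vs" for vs
    by (rule ext_map_repeated[OF alt4 that])
  have swap2: "w3_1 [e3, e1] = - w3_1 [e1, e3]" "w3_1 [e2, e1] = - w3_1 [e1, e2]"
     "w3_1 [e3, e2] = - w3_1 [e2, e3]" "w3_1 [a2 *v f, v] = - w3_1 [v, a2 *v f]" for v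
    by (rule ext_map_2_swap[OF alt2])+
  \<comment> \<open>The surviving $w^{(3)}_2$ terms for \<open>e\<close> equal to $e_1$, $e_2$ and $e_3$, with $a_2f$ moved to
    the end as in the lifting property of $w^{(2)}_2$.\<close>
  have cyc: "w3_2 [a2 *v f, e2, e3, e1] = - w3_2 [e1, e2, e3, a2 *v f]"
    "w3_2 [a2 *v f, e1, e3, e2] = w3_2 [e1, e2, e3, a2 *v f]"
    "w3_2 [a2 *v f, e1, e2, e3] = - w3_2 [e1, e2, e3, a2 *v f]"
  proof -
    have "w3_2 [a2 *v f, e2, e3, e1] = - w3_2 [e2, e3, e1, a2 *v f]"
      by (rule ext_map_4_rotate[OF alt4])
    also have "w3_2 [e2, e3, e1, a2 *v f] = - w3_2 [e2, e1, e3, a2 *v f]"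
      by (rule ext_map_4_swap(2)[OF alt4])
    also have "w3_2 [e2, e1, e3, a2 *v f] = - w3_2 [e1, e2, e3, a2 *v f]"
      by (rule ext_map_4_swap(1)[OF alt4])
    finally show "w3_2 [a2 *v f, e2, e3, e1] = - w3_2 [e1, e2, e3, a2 *v f]" by simp
    have "w3_2 [a2 *v f, e1, e3, e2] = - w3_2 [e1, e3, e2, a2 *v f]"
      by (rule ext_map_4_rotate[OF alt4])
    also have "w3_2 [e1, e3, e2, a2 *v f] = - w3_2 [e1, e2, e3, a2 *v f]"
      by (rule ext_map_4_swap(2)[OF alt4])
    finally show "w3_2 [a2 *v f, e1, e3, e2] = w3_2 [e1, e2, e3, a2 *v f]" by simp
    show "w3_2 [a2 *v f, e1, e2, e3] = - w3_2 [e1, e2, e3, a2 *v f]"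
      by (rule ext_map_4_rotate[OF alt4])
  qed
  let ?es = "[a2 *v f, e1, e2, e3]"
  have L: "map_snd ((*v) a3) (w1_21 ?es e) =
     (\<Sum>i<4. (- 1) ^ i *s tensor (w1_1 (omit i ?es)) (w3_1 [?es ! i, e])) +
     (\<Sum>i<4. (- 1) ^ i *s (pairing x (?es ! i) *s w3_2 (omit i ?es @ [e])))"
    using w1_21 by (simp add: is_w1_21_def)
  have c2: "map_snd ((*v) a3) (w2_2 [e1, e2, e3] f) =
          tensor (w2_1 e3 f) (w3_1 [e1, e2]) - tensor (w2_1 e2 f) (w3_1 [e1, e3]) +
          tensor (w2_1 e1 f) (w3_1 [e2, e3]) + w3_2 [e1, e2, e3, a2 *v f] -
          tensor (w1_1 [e1, e2, e3]) f"
    using w2_2 by (simp add: is_w2_2_def)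
  have c1: "a3 *v w2_1 e f = pairing x e *s f - w3_1 [e, a2 *v f]" for e
    using w2_1 by (simp add: is_w2_1_def)
  have c0: "a3 *v w1_1 [e1, e2, e3] =
      pairing x e1 *s w3_1 [e2, e3] - pairing x e2 *s w3_1 [e1, e3] + pairing x e3 *s w3_1 [e1, e2]"
    using w1_1 by (simp add: is_w1_1_def)
  note w11 = w1_1_on_boundaries[OF inj x_a2 w3_1 w2_1 w1_1]
  show "map_snd ((*v) a3) (w1_21 [a2 *v f, e1, e2, e3] e) = map_snd ((*v) a3)
     (wedge (w1_1 [e1, e2, e3]) (w2_1 e f) + pairing x e *s w2_2 [e1, e2, e3] f)"
    unfolding L map_snd_matrix c2 c1 c0
    using e
    by (elim insertE emptyE; simp add: eval_nat_numeral omit_def x_a2 w11 rep2 rep4;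
       simp add: swap2 cyc;
       simp add: vec_eq_iff tensor_def algebra_simps)
qed

text \<open>The product $F\otimes\bigwedge^2F\to\bigwedge^3F$, with exterior powers realised as alternating tensors.
  The three terms are the shuffles, so there is no factor \<open>1/2\<close>.\<close>

definition wedge12 :: "'r::comm_ring_1 ^ 'l \<Rightarrow> 'r ^ ('l \<times> 'l) \<Rightarrow> 'r ^ (('l \<times> 'l) \<times> 'l)" where
  "wedge12 v \<omega> = vec_lambda
     (\<lambda>((t, u), s). v $ t * \<omega> $ (u, s) - v $ u * \<omega> $ (t, s) + v $ s * \<omega> $ (t, u))"

text \<open>Apply $a_3$ to the last factor and write \<open>v\<close> and \<open>\<omega>\<close> for the factors of the right-hand side.
  It becomes \<open>v \<and> a\<^sub>3(\<omega>) + \<omega> \<otimes> a\<^sub>3(v)\<close>. On the left, the values of $w^{(1)}_{2,1}$ supply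
  \<open>\<omega> \<otimes> a\<^sub>3(v)\<close> and \<open>v \<and>\<close> the first three terms of \<open>a\<^sub>3(\<omega>)\<close>; the only nonzero term with
  $w^{(3)}_2$ supplies the fourth, and the fifth, \<open>- v \<otimes> f\<close>, is killed by \<open>v \<and> v = 0\<close>.\<close>

lemma w1_31_on_boundaries:
  fixes x :: "'r::comm_ring_1 ^ 'n::finite" and a2 :: "'r ^ 'm::finite ^ 'n" and a3 :: "'r ^ 'l::finite ^ 'm"
  assumes inj: "inj ((*v) a3)" and x_a2: "\<And>f. pairing x (a2 *v f) = 0"
    and w3_1: "is_w3_1 x a2 w3_1"
    and w2_1: "is_w2_1 x a2 a3 w3_1 w2_1"
    and w1_1: "is_w1_1 x a3 w3_1 w1_1"
    and w3_2: "is_w3_2 a3 w3_1 w3_2"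
    and w2_2: "is_w2_2 a2 a3 w3_1 w2_1 w1_1 w3_2 w2_2"
    and w3_31: "is_w3_31 a3 w3_1 w3_2 w3_31"
    and w1_21: "is_w1_21 x a3 w3_1 w1_1 w3_2 w1_21"
    and w1_31: "is_w1_31 x a3 w3_1 w1_1 w3_2 w3_31 w1_21 w1_31"
  shows "w1_31 [a2 *v f, e1, e2, e3] [e1, e2, e3] = wedge12 (w1_1 [e1, e2, e3]) (w2_2 [e1, e2, e3] f)"
proof (rule map_snd_inj[OF inj])
  let ?v = "w1_1 [e1, e2, e3]" and ?\<omega> = "w2_2 [e1, e2, e3] f"
  let ?es = "[a2 *v f, e1, e2, e3]" and ?hs = "[e1, e2, e3]"
  have rep4: "w3_2 vs = 0" if "length vs = 4" "\<not> distinct vs" for vs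
    using w3_2 that by (auto simp: is_w3_2_def intro: ext_map_repeated)
  have rep5: "w3_31 vs e = 0" if "length vs = 5" "\<not> distinct vs" for vs e
    using w3_31 that by (intro ext_map_repeated[of 5 "\<lambda>vs. w3_31 vs e"]) (auto simp: is_w3_31_def)
  \<comment> \<open>In each term either $a_1(a_2f) = 0$ is a factor, or $w^{(3)}_{3,1}$ has among its five alternating
    arguments four from $\{e_1, e_2, e_3\}$.\<close>
  have third: "(\<Sum>i<4. \<Sum>j<3. (- 1) ^ (i + j) *s
             (pairing x (?es ! i) *s w3_31 (omit i ?es @ omit j ?hs) (?hs ! j))) = 0"
    by (simp add: eval_nat_numeral omit_def x_a2 rep5)
  have b: "w1_21 ?es e = wedge ?v (w2_1 e f) + pairing x e *s ?\<omega>" if "e \<in> {e1, e2, e3}" for e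
    using w1_21_on_boundaries[OF inj x_a2 w3_1 w2_1 w1_1 w3_2 w2_2 w1_21 that] .
  have "map_snd ((*v) a3) (w1_31 ?es ?hs) =
     (\<Sum>i<3. (- 1) ^ i *s tensor (w1_21 ?es (?hs ! i)) (w3_1 (omit i ?hs))) +
          (\<Sum>i<4. (- 1) ^ i *s
             map_fst (wedge (w1_1 (omit i ?es))) (w3_2 (?hs @ [?es ! i]))) -
          (2 * ring_inv 3) *s (\<Sum>i<4. \<Sum>j<3. (- 1) ^ (i + j) *s
             (pairing x (?es ! i) *s w3_31 (omit i ?es @ omit j ?hs) (?hs ! j)))"
    using w1_31 by (simp add: is_w1_31_def)
  also have "\<dots> = (tensor (w1_21 ?es e1) (w3_1 [e2, e3]) - tensor (w1_21 ?es e2) (w3_1 [e1, e3])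
        + tensor (w1_21 ?es e3) (w3_1 [e1, e2])) + map_fst (wedge ?v) (w3_2 [e1, e2, e3, a2 *v f])"
    unfolding third
    by (simp add: eval_nat_numeral omit_def rep4)
       (auto simp add: vec_eq_iff map_fst_def wedge_def tensor_def)
  also have "\<dots> = map_fst (wedge ?v) (map_snd ((*v) a3) ?\<omega>) + tensor ?\<omega> (a3 *v ?v)"
  proof -
    have c2: "map_snd ((*v) a3) ?\<omega> =
          tensor (w2_1 e3 f) (w3_1 [e1, e2]) - tensor (w2_1 e2 f) (w3_1 [e1, e3]) +
          tensor (w2_1 e1 f) (w3_1 [e2, e3]) + w3_2 [e1, e2, e3, a2 *v f] - tensor ?v f"
      using w2_2 by (simp add: is_w2_2_def)
    have c0: "a3 *v ?v =
      pairing x e1 *s w3_1 [e2, e3] - pairing x e2 *s w3_1 [e1, e3] + pairing x e3 *s w3_1 [e1, e2]"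
      using w1_1 by (simp add: is_w1_1_def)
    show ?thesis unfolding c2 c0
      by (simp add: b) (simp add: vec_eq_iff map_fst_def wedge_def tensor_def algebra_simps)
  qed
  also have "\<dots> = map_snd ((*v) a3) (wedge12 ?v ?\<omega>)"
    by (simp add: vec_eq_iff map_fst_def map_snd_def wedge_def tensor_def wedge12_def
        matrix_vector_mult_def algebra_simps sum.distrib sum_subtractf sum_distrib_left)
  finally show "map_snd ((*v) a3) (w1_31 ?es ?hs) = map_snd ((*v) a3) (wedge12 ?v ?\<omega>)" .
qed


section \<open>The triple products\<close>

text \<open>The coefficient of $s_j\cdot s_k$ at $t_i$ is the sign of the permutation $(j, k, i)$ of $(1, 2, 3)$,
  or zero. This is the second component of the relation for $\gamma\cdot s_j\cdot s_k$.\<close>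

lemma mult2_ess_ess:
  assumes \<mu>2: "is_mult2 U w2_1 w2_2 \<mu>2" and f: "ext_map 3 f"
  shows "f (eps_s U) $ t *s \<mu>2 [ess j, ess k] =
    dsum 0 (\<chi> i. f [alpha1 U j, alpha1 U k, alpha1 U i] $ t)"
proof -
  have alt: "ext_map 2 \<mu>2" using \<mu>2 by (simp add: is_mult2_def)
  have \<mu>: "\<mu>2 [ess 1, ess 2] = dsum 0 (axis 3 1)" "\<mu>2 [ess 1, ess 3] = - dsum 0 (axis 2 1)"
     "\<mu>2 [ess 2, ess 3] = dsum 0 (axis 1 1)"
    using \<mu>2 by (simp_all add: is_mult2_def)
  have \<mu>': "\<mu>2 [ess 2, ess 1] = - dsum 0 (axis 3 1)" "\<mu>2 [ess 3, ess 1] = dsum 0 (axis 2 1)"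
     "\<mu>2 [ess 3, ess 2] = - dsum 0 (axis 1 1)" "\<mu>2 [y, y] = 0" for y
    using ext_map_2_swap[OF alt, of "ess 2" "ess 1"] ext_map_2_swap[OF alt, of "ess 3" "ess 1"]
      ext_map_2_swap[OF alt, of "ess 3" "ess 2"] ext_map_repeated[OF alt, of "[y, y]"] \<mu>
    by simp_all
  have rep: "f [a, a, b] = 0" "f [a, b, a] = 0" "f [b, a, a] = 0" for a b
    by (rule ext_map_repeated[OF f]; simp)+
  have perm: "f [b, a, c] = - f [a, b, c]" "f [a, c, b] = - f [a, b, c]" "f [b, c, a] = f [a, b, c]"
     "f [c, a, b] = f [a, b, c]" "f [c, b, a] = - f [a, b, c]" for a b c
  proof -
    show 1: "f [b, a, c] = - f [a, b, c]" and 2: "f [a, c, b] = - f [a, b, c]"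
      by (rule ext_map_3_swap[OF f])+
    show 3: "f [b, c, a] = f [a, b, c]"
      using ext_map_3_swap(2)[OF f, of b a c] 1 by simp
    show 4: "f [c, a, b] = f [a, b, c]"
      using ext_map_3_swap(1)[OF f, of a c b] 2 by simp
    show "f [c, b, a] = - f [a, b, c]"
      using ext_map_3_swap(1)[OF f, of b c a] 3 by simp
  qed
  note perm' = perm[where a = "alpha1 U 1" and b = "alpha1 U 2" and c = "alpha1 U 3"]
  show ?thesis
    using exhaust_3[of j] exhaust_3[of k]
    by (elim disjE; simp only: \<mu> \<mu>' vec_eq_iff dsum_def eps_s_def;
        auto simp: forall_3 axis_def rep perm' split: sum.splits)
qed

theorem theorem3p7:
  fixes M I J :: "'r::comm_ring_1 set"
    and x :: "'r ^ 'n::finite"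
    and a2 :: "'r ^ 'm::finite ^ 'n"
    and a3 :: "'r ^ 'l::finite ^ 'm"
    and U :: "'r ^ 3 ^ 'n"
    and w3_1 :: "('r ^ 'n) list \<Rightarrow> 'r ^ 'm"
    and w2_1 :: "'r ^ 'n \<Rightarrow> 'r ^ 'm \<Rightarrow> 'r ^ 'l"
    and w1_1 :: "('r ^ 'n) list \<Rightarrow> 'r ^ 'l"
    and w3_2 :: "('r ^ 'n) list \<Rightarrow> 'r ^ ('l \<times> 'm)"
    and w2_2 :: "('r ^ 'n) list \<Rightarrow> 'r ^ 'm \<Rightarrow> 'r ^ ('l \<times> 'l)"
    and w3_31 :: "('r ^ 'n) list \<Rightarrow> 'r ^ 'n \<Rightarrow> 'r ^ (('l \<times> 'l) \<times> 'm)"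
    and w1_21 :: "('r ^ 'n) list \<Rightarrow> 'r ^ 'n \<Rightarrow> 'r ^ ('l \<times> 'l)"
    and w1_31 :: "('r ^ 'n) list \<Rightarrow> ('r ^ 'n) list \<Rightarrow> 'r ^ (('l \<times> 'l) \<times> 'l)"
    and \<mu>2 :: "('r ^ ('l + 3)) list \<Rightarrow> 'r ^ ('m + 3)"
    and \<mu>3 :: "('r ^ ('l + 3)) list \<Rightarrow> 'r ^ 'n"
  assumes gorenstein: "gorenstein_ring TYPE('r)"
    and local_or_graded:
      "local_ring M \<or> (\<exists>G. graded_local_ring G M \<and> graded_complex3 G x a2 a3)"
    and units: "2 \<notin> M" "3 \<notin> M"
    and perfect: "perfect_ideal I" "ideal_height I = 3"
    and resolution: "free_resolution3 I x a2 a3" "minimal_complex3 M x a2 a3"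
    and regular: "regular_sequence [kos x U $ 1, kos x U $ 2, kos x U $ 3]"
    and link:
      "J = ideal_quotient (ideal_gen {kos x U $ 1, kos x U $ 2, kos x U $ 3}) I"
    and w3_1: "is_w3_1 x a2 w3_1"
    and w2_1: "is_w2_1 x a2 a3 w3_1 w2_1"
    and w1_1: "is_w1_1 x a3 w3_1 w1_1"
    and w3_2: "is_w3_2 a3 w3_1 w3_2"
    and w2_2: "is_w2_2 a2 a3 w3_1 w2_1 w1_1 w3_2 w2_2"
    and w3_31: "is_w3_31 a3 w3_1 w3_2 w3_31"
    and w1_21: "is_w1_21 x a3 w3_1 w1_1 w3_2 w1_21"
    and w1_31: "is_w1_31 x a3 w3_1 w1_1 w3_2 w3_31 w1_21 w1_31"
    and mult2: "is_mult2 U w2_1 w2_2 \<mu>2"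
    and mult3: "is_mult3 x a2 U w1_1 \<mu>2 \<mu>3"
  shows "\<mu>3 [ess 1, ess 2, ess 3] = (\<Sum>i\<in>UNIV. x $ i *s axis i 1)
    \<and> (\<forall>t j k. \<mu>3 [gam t, ess j, ess k] =
        (\<Sum>i\<in>UNIV. pairing (w1_1 [alpha1 U j, alpha1 U k, axis i 1]) (axis t 1) *s axis i 1))
    \<and> (\<forall>t u j. \<mu>3 [gam t, gam u, ess j] =
        (\<Sum>i\<in>UNIV. pairing2 (w1_21 (axis i 1 # eps_s U) (alpha1 U j))
           (axis t 1) (axis u 1) *s axis i 1))
    \<and> (\<forall>t u v. \<mu>3 [gam t, gam u, gam v] =
        (\<Sum>i\<in>UNIV. pairing3 (w1_31 (axis i 1 # eps_s U) (eps_s U))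
           (axis t 1) (axis u 1) (axis v 1) *s axis i 1))"
proof -
  have inj: "inj ((*v) a3)" and x_a2: "pairing x (a2 *v f) = 0" for f
    using resolution by (auto simp: free_resolution3_def)
  \<comment> \<open>The condition on the first member of a regular sequence, modulo the ideal generated by the
    empty set.\<close>
  have reg: "r = 0" if "r * kos x U $ 1 = 0" for r
    using regular that
    by (auto simp: regular_sequence_def module.span_empty[OF module_mult] dest!: spec[of _ "0::nat"])
  note d3_inj = cone_d3_inj[OF w3_1 reg]
  have d3: "cone_d3 a2 U (\<mu>3 [y, z, v]) =
        cone_d1 x U w1_1 y *s \<mu>2 [z, v] - cone_d1 x U w1_1 z *s \<mu>2 [y, v] +
        cone_d1 x U w1_1 v *s \<mu>2 [y, z]" for y z v
    using mult3 by (simp add: is_mult3_def)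
  have ess12: "\<mu>2 [ess 1, ess 2] = dsum 0 (axis 3 1)" "\<mu>2 [ess 1, ess 3] = - dsum 0 (axis 2 1)"
     "\<mu>2 [ess 2, ess 3] = dsum 0 (axis 1 1)"
    using mult2 by (simp_all add: is_mult2_def)
  have gam_ess: "\<mu>2 [gam t, ess j] = dsum (\<chi> h. w2_1 (alpha1 U j) (axis h 1) $ t) 0" for t j
    using mult2 by (simp add: is_mult2_def pairing_axis)
  have gam_gam: "\<mu>2 [gam t, gam u] = dsum (\<chi> h. w2_2 (eps_s U) (axis h 1) $ (t, u)) 0" for t u
    using mult2 by (simp add: is_mult2_def pairing2_def tensor_axis pairing_axis)
  have alt3: "ext_map 3 w1_1" and alt4: "ext_map 4 (\<lambda>es. w1_21 es e)"
    and alt4': "ext_map 4 (\<lambda>es. w1_31 es (eps_s U))" for e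
    using w1_1 w1_21 w1_31 by (simp_all add: is_w1_1_def is_w1_21_def is_w1_31_def eps_s_def)
  have alpha_eps: "alpha1 U j \<in> {alpha1 U 1, alpha1 U 2, alpha1 U 3}" for j
    using exhaust_3[of j] by auto
  have "\<mu>3 [ess 1, ess 2, ess 3] = x"
  proof (rule d3_inj)
    show "cone_d3 a2 U (\<mu>3 [ess 1, ess 2, ess 3]) = cone_d3 a2 U x"
      unfolding d3 cone_d3_generators[OF x_a2] ess12 cone_d1_ess
      by (auto simp: vec_eq_iff dsum_def axis_def forall_3 split: sum.splits)
  qed
  moreover have "\<mu>3 [gam t, ess j, ess k] = (\<chi> i. w1_1 [alpha1 U j, alpha1 U k, axis i 1] $ t)" for t j k
  proof (rule d3_inj)
    have lin: "lin_map (\<lambda>e. w1_1 [alpha1 U j, alpha1 U k, e])"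
      using ext_map_lin_last[of 2 w1_1 "[alpha1 U j, alpha1 U k]"] alt3 by simp
    have cyc: "w1_1 [alpha1 U j, alpha1 U k, a2 *v f] = w1_1 [a2 *v f, alpha1 U j, alpha1 U k]" for f
      using ext_map_3_swap(1)[OF alt3, of "alpha1 U j" "a2 *v f" "alpha1 U k"]
        ext_map_3_swap(2)[OF alt3, of "alpha1 U j" "alpha1 U k" "a2 *v f"] by simp
    show "cone_d3 a2 U (\<mu>3 [gam t, ess j, ess k]) =
      cone_d3 a2 U (\<chi> i. w1_1 [alpha1 U j, alpha1 U k, axis i 1] $ t)"
      unfolding d3 cone_d3_functional[OF lin] cone_d1_gam cone_d1_ess mult2_ess_ess[OF mult2 alt3]
        gam_ess cyc w1_1_on_boundaries[OF inj x_a2 w3_1 w2_1 w1_1] pairing_alpha1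
      by (auto simp: vec_eq_iff dsum_def split: sum.splits)
  qed
  moreover have "\<mu>3 [gam t, gam u, ess j] =
    (\<chi> i. w1_21 (axis i 1 # eps_s U) (alpha1 U j) $ (t, u))" for t u j
  proof (rule d3_inj)
    have lin: "lin_map (\<lambda>e. w1_21 (e # eps_s U) (alpha1 U j))"
      using ext_map_lin_hd[of 3 "\<lambda>es. w1_21 es (alpha1 U j)" "eps_s U"] alt4 by (simp add: eps_s_def)
    have zero: "w1_21 (alpha1 U i # eps_s U) (alpha1 U j) = 0" for i
      using alpha_eps[of i] by (intro ext_map_repeated[OF alt4]) (auto simp: eps_s_def)
    have boundary: "w1_21 (a2 *v f # eps_s U) (alpha1 U j) =
      wedge (w1_1 (eps_s U)) (w2_1 (alpha1 U j) f) + kos x U $ j *s w2_2 (eps_s U) f" for f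
      using w1_21_on_boundaries[OF inj x_a2 w3_1 w2_1 w1_1 w3_2 w2_2 w1_21 alpha_eps]
      by (simp add: eps_s_def pairing_alpha1)
    show "cone_d3 a2 U (\<mu>3 [gam t, gam u, ess j]) =
      cone_d3 a2 U (\<chi> i. w1_21 (axis i 1 # eps_s U) (alpha1 U j) $ (t, u))"
      unfolding d3 cone_d3_functional[OF lin] cone_d1_gam cone_d1_ess gam_ess gam_gam zero boundary
      by (auto simp: vec_eq_iff dsum_def wedge_def tensor_def split: sum.splits)
  qed
  moreover have "\<mu>3 [gam t, gam u, gam v] =
    (\<chi> i. w1_31 (axis i 1 # eps_s U) (eps_s U) $ ((t, u), v))" for t u v
  proof (rule d3_inj)
    have lin: "lin_map (\<lambda>e. w1_31 (e # eps_s U) (eps_s U))"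
      using ext_map_lin_hd[of 3 "\<lambda>es. w1_31 es (eps_s U)" "eps_s U"] alt4' by (simp add: eps_s_def)
    have zero: "w1_31 (alpha1 U i # eps_s U) (eps_s U) = 0" for i
      using alpha_eps[of i] by (intro ext_map_repeated[OF alt4']) (auto simp: eps_s_def)
    have boundary: "w1_31 (a2 *v f # eps_s U) (eps_s U) =
      wedge12 (w1_1 (eps_s U)) (w2_2 (eps_s U) f)" for f
      using w1_31_on_boundaries[OF inj x_a2 w3_1 w2_1 w1_1 w3_2 w2_2 w3_31 w1_21 w1_31]
      by (simp add: eps_s_def)
    show "cone_d3 a2 U (\<mu>3 [gam t, gam u, gam v]) =
      cone_d3 a2 U (\<chi> i. w1_31 (axis i 1 # eps_s U) (eps_s U) $ ((t, u), v))"
      unfolding d3 cone_d3_functional[OF lin] cone_d1_gam gam_gam zero boundary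
      by (auto simp: vec_eq_iff dsum_def wedge12_def split: sum.splits)
  qed
  moreover have "(\<Sum>i\<in>UNIV. c i *s axis i 1) = (\<chi> i. c i)" for c :: "'n \<Rightarrow> 'r"
    using basis_expansion[of "\<chi> i. c i"] by simp
  ultimately show ?thesis
    by (simp add: pairing_axis pairing2_def pairing3_def tensor_axis)
qed

end
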